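(* If $N$ is the size of the sample space $\Omega$, there are no more than $(N-1)!$ admissible lower bounds over $\Omega$.
   Context: Fix a finite nonempty set $S\subset\mathbb{R}$, an integer $n\ge 1$ and $\alpha\in(0,1)$ (the confidence level is $1-\alpha$). The sample space is $\Omega=\Omega(S,n)=\{(x_1,\dots,x_n)\in S^n: x_1\le\dots\le x_n\}$. $\mathcal{F}=\mathcal{F}(S)$ is the closed simplex of all probability distributions on $S$ (zero masses allowed), and $\mu(F)=\sum_{s\in S}sF(s)$. For $x\in\Omega$ containing $\hat x_s$ copies of $s$, $\Pr_F(x)=\frac{n!}{\prod_{s}\hat x_s!}\prod_{s\in S}F(s)^{\hat x_s}$ (with $0^0=1$), and $\Pr_F(A)=\sum_{x\in A}\Pr_F(x)$ for $A\subseteq\Omega$. A lower bound is any map $B:\Omega\to[-\infty,\infty]$. It is valid if $\Pr_F(\{x\in\Omega: B(x)>\mu(F)\})\le\alpha$ for every $F\in\mathcal{F}$. For valid bounds, $B_1$ dominates $B_2$ if $B_1(x)\ge B_2(x)$ for all $x\in\Omega$ with strict inequality for at least one $x$. A bound $B$ is admissible if it is valid and no valid bound dominates it. *)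

theory Defs
  imports "HOL-Probability.Probability_Mass_Function"
begin

definition sample_space :: "real set \<Rightarrow> nat \<Rightarrow> real list set" where
  "sample_space S n = {x. length x = n \<and> set x \<subseteq> S \<and> sorted x}"

definition distributions :: "real set \<Rightarrow> real pmf set" where
  "distributions S = {F. set_pmf F \<subseteq> S}"

definition mean :: "real set \<Rightarrow> real pmf \<Rightarrow> real" where
  "mean S F = (\<Sum>s\<in>S. s * pmf F s)"

text \<open>A sorted list stands for all orderings of the same i.i.d. sample, hence the multinomial
  coefficient.\<close>

definition sample_prob :: "real set \<Rightarrow> nat \<Rightarrow> real pmf \<Rightarrow> real list \<Rightarrow> real" where
  "sample_prob S n F x =
     fact n / (\<Prod>s\<in>S. fact (count_list x s)) * (\<Prod>s\<in>S. pmf F s ^ count_list x s)"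

definition event_prob :: "real set \<Rightarrow> nat \<Rightarrow> real pmf \<Rightarrow> real list set \<Rightarrow> real" where
  "event_prob S n F A = (\<Sum>x\<in>A. sample_prob S n F x)"

text \<open>Bounds are extensional functions (\<^term>\<open>undefined\<close> outside the sample space), so that two maps
  agreeing on the sample space are the same bound and counting bounds is meaningful.\<close>

definition lower_bounds :: "real set \<Rightarrow> nat \<Rightarrow> (real list \<Rightarrow> ereal) set" where
  "lower_bounds S n = (sample_space S n \<rightarrow>\<^sub>E UNIV)"

definition valid_bound :: "real set \<Rightarrow> nat \<Rightarrow> real \<Rightarrow> (real list \<Rightarrow> ereal) \<Rightarrow> bool" where
  "valid_bound S n \<alpha> B \<longleftrightarrow> B \<in> lower_bounds S n \<and>
     (\<forall>F\<in>distributions S. event_prob S n F {x \<in> sample_space S n. B x > ereal (mean S F)} \<le> \<alpha>)"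

definition dominates ::
    "real set \<Rightarrow> nat \<Rightarrow> (real list \<Rightarrow> ereal) \<Rightarrow> (real list \<Rightarrow> ereal) \<Rightarrow> bool" where
  "dominates S n B1 B2 \<longleftrightarrow>
     (\<forall>x\<in>sample_space S n. B1 x \<ge> B2 x) \<and> (\<exists>x\<in>sample_space S n. B1 x > B2 x)"

definition admissible_bound :: "real set \<Rightarrow> nat \<Rightarrow> real \<Rightarrow> (real list \<Rightarrow> ereal) \<Rightarrow> bool" where
  "admissible_bound S n \<alpha> B \<longleftrightarrow>
     valid_bound S n \<alpha> B \<and> \<not> (\<exists>B'. valid_bound S n \<alpha> B' \<and> dominates S n B' B)"

end

theory Submission
  imports Defs "HOL-Combinatorics.Multiset_Permutations"
begin

text \<open>
  An admissible bound \<open>B\<close> is determined by the order in which \<open>B\<close> ranks the samples. If the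
  samples are listed with \<open>B\<close> decreasing and \<open>A\<close> collects those up to and including \<open>x\<close>, then \<open>B x\<close>
  cannot exceed the mean of any distribution giving \<open>A\<close> probability above \<open>\<alpha>\<close>, since \<open>A\<close> would be
  contained in the error event of that distribution. Taking the infimum of all these means as the
  value at \<open>x\<close> gives a bound that depends on the listing alone, is nowhere below \<open>B\<close>, and is itself valid
  (\<open>valid_bound_ranking_bound\<close>). By admissibility it equals \<open>B\<close>. Hence there are no more admissible
  bounds than listings of the sample space, which would give \<open>N!\<close>.

  One factor \<open>N\<close> is saved because the sample consisting only of \<open>m = Min S\<close> can always be listed
  last, whatever \<open>B\<close> is. The point mass at \<open>m\<close> produces this sample with certainty, so a
  valid bound is at most \<open>m\<close> there; and no infimum of means falls below \<open>m\<close>. The comparison with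
  \<open>B\<close> therefore survives at this sample without any assumption on how \<open>B\<close> ranks it, and only the
  order of the remaining \<open>N - 1\<close> samples matters.
\<close>

section \<open>Probabilities of samples\<close>

lemma finite_sample_space: "finite S \<Longrightarrow> finite (sample_space S n)"
  by (rule finite_subset[OF _ finite_lists_length_eq[of S n]]) (auto simp: sample_space_def)

lemma sample_prob_nonneg: "0 \<le> sample_prob S n F x"
  unfolding sample_prob_def by (intro mult_nonneg_nonneg divide_nonneg_nonneg prod_nonneg) auto

lemma event_prob_mono:
  assumes "finite A'" and "A \<subseteq> A'"
  shows "event_prob S n F A \<le> event_prob S n F A'"
  unfolding event_prob_def using assms sample_prob_nonneg by (intro sum_mono2) auto

lemma mean_ge_Min:
  assumes "finite S" and F: "F \<in> distributions S"
  shows "Min S \<le> mean S F"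
proof -
  have "Min S = (\<Sum>s\<in>S. Min S * pmf F s)"
    using assms by (simp add: distributions_def sum_distrib_left[symmetric] sum_pmf_eq_1)
  also have "\<dots> \<le> mean S F"
    unfolding mean_def using assms by (intro sum_mono mult_right_mono) auto
  finally show ?thesis .
qed

lemma sample_prob_return_pmf_replicate:
  assumes "finite S" and "a \<in> S"
  shows "sample_prob S n (return_pmf a) (replicate n a) = 1"
proof -
  have count: "count_list (replicate k a) s = (if s = a then k else 0)" for k s
    by (induction k) auto
  have "(\<Prod>s\<in>S. fact (count_list (replicate n a) s)) = (\<Prod>s\<in>S. if s = a then fact n else 1 :: real)"
    unfolding count by (intro prod.cong) auto
  moreover have "(\<Prod>s\<in>S. pmf (return_pmf a) s ^ count_list (replicate n a) s) = 1"
    unfolding count by (intro prod.neutral) auto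
  ultimately show ?thesis
    using assms by (simp add: sample_prob_def)
qed

lemma mean_return_pmf:
  assumes "finite S" and "a \<in> S"
  shows "mean S (return_pmf a) = a"
proof -
  have "mean S (return_pmf a) = (\<Sum>s\<in>S. if s = a then s else 0)"
    unfolding mean_def by (intro sum.cong) (auto simp: pmf_return)
  then show ?thesis using assms by simp
qed

text \<open>Otherwise the point mass at \<open>a\<close> would put all of its probability on an erroneous sample.\<close>

lemma valid_bound_replicate_le:
  assumes "finite S" and "a \<in> S" and "\<alpha> < 1" and B: "valid_bound S n \<alpha> B"
  shows "B (replicate n a) \<le> ereal a"
proof (rule ccontr)
  let ?E = "{x \<in> sample_space S n. B x > ereal (mean S (return_pmf a))}"
  assume "\<not> B (replicate n a) \<le> ereal a"
  then have "{replicate n a} \<subseteq> ?E"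
    using assms by (auto simp: mean_return_pmf sample_space_def)
  then have "event_prob S n (return_pmf a) {replicate n a} \<le> event_prob S n (return_pmf a) ?E"
    using assms finite_sample_space by (intro event_prob_mono) auto
  also have "\<dots> \<le> \<alpha>"
    using B \<open>a \<in> S\<close> by (auto simp: valid_bound_def distributions_def)
  finally show False
    using assms by (simp add: event_prob_def sample_prob_return_pmf_replicate)
qed

section \<open>The bound determined by a ranking\<close>

text \<open>The infimum is \<open>\<infinity>\<close> when no distribution gives \<open>A\<close> probability above \<open>\<alpha>\<close>:
  the bound that is \<open>\<infinity>\<close> on such an \<open>A\<close> and \<open>-\<infinity>\<close> elsewhere is valid.\<close>

definition least_plausible_mean :: "real set \<Rightarrow> nat \<Rightarrow> real \<Rightarrow> real list set \<Rightarrow> ereal" where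
  "least_plausible_mean S n \<alpha> A =
     (INF F \<in> {F \<in> distributions S. event_prob S n F A > \<alpha>}. ereal (mean S F))"

lemma event_prob_le_of_least_plausible_mean:
  assumes "F \<in> distributions S" and "ereal (mean S F) < least_plausible_mean S n \<alpha> A"
  shows "event_prob S n F A \<le> \<alpha>"
proof (rule ccontr)
  assume "\<not> event_prob S n F A \<le> \<alpha>"
  then have "least_plausible_mean S n \<alpha> A \<le> ereal (mean S F)"
    unfolding least_plausible_mean_def using assms(1) by (intro INF_lower) auto
  then show False using assms(2) by simp
qed

lemma Min_le_least_plausible_mean:
  "finite S \<Longrightarrow> ereal (Min S) \<le> least_plausible_mean S n \<alpha> A"
  unfolding least_plausible_mean_def by (intro INF_greatest) (auto intro: mean_ge_Min)

definition up_to :: "'a list \<Rightarrow> 'a \<Rightarrow> 'a set" where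
  "up_to xs x = insert x (set (takeWhile (\<lambda>y. y \<noteq> x) xs))"

lemma up_to_self: "x \<in> up_to xs x"
  by (simp add: up_to_def)

lemma up_to_subset: "x \<in> set xs \<Longrightarrow> up_to xs x \<subseteq> set xs"
  by (auto simp: up_to_def dest: set_takeWhileD)

lemma up_to_append: "x \<in> set xs \<Longrightarrow> up_to (xs @ ys) x = up_to xs x"
  by (simp add: up_to_def)

lemma up_to_chain:
  "x \<in> set xs \<Longrightarrow> y \<in> set xs \<Longrightarrow> up_to xs x \<subseteq> up_to xs y \<or> up_to xs y \<subseteq> up_to xs x"
proof (induction xs)
  case (Cons a xs)
  then show ?case by (cases "x = a"; cases "y = a") (auto simp: up_to_def)
qed simp

lemma sorted_wrt_up_to:
  assumes "sorted_wrt R xs" and "reflp R" and "x \<in> set xs" and "z \<in> up_to xs x"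
  shows "R z x"
  using assms
proof (induction xs)
  case (Cons a xs)
  then show ?case by (cases "x = a") (auto simp: up_to_def reflp_def)
qed simp

definition ranking_bound :: "real set \<Rightarrow> nat \<Rightarrow> real \<Rightarrow> real list list \<Rightarrow> real list \<Rightarrow> ereal" where
  "ranking_bound S n \<alpha> xs =
     restrict (\<lambda>x. least_plausible_mean S n \<alpha> (up_to xs x)) (sample_space S n)"

text \<open>The initial segments of the ranking form a chain, so a nonempty error event is contained in a
  single one of them, namely in the largest segment belonging to an erroneous sample. The infimum
  for that segment exceeds the true mean, so the segment has probability at most \<open>\<alpha>\<close>.\<close>

lemma valid_bound_ranking_bound:
  assumes "finite S" and "0 < \<alpha>" and xs: "set xs = sample_space S n"
  shows "valid_bound S n \<alpha> (ranking_bound S n \<alpha> xs)"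
  unfolding valid_bound_def
proof (intro conjI ballI)
  show "ranking_bound S n \<alpha> xs \<in> lower_bounds S n"
    by (simp add: ranking_bound_def lower_bounds_def)
next
  fix F assume F: "F \<in> distributions S"
  define E where "E = {x \<in> sample_space S n. ranking_bound S n \<alpha> xs x > ereal (mean S F)}"
  have E: "E \<subseteq> set xs" by (auto simp: E_def xs)
  then have finE: "finite E" by (rule finite_subset) simp
  have "event_prob S n F E \<le> \<alpha>"
  proof (cases "E = {}")
    case True
    then show ?thesis using \<open>0 < \<alpha>\<close> by (simp add: event_prob_def)
  next
    case False
    obtain A where A: "A \<in> up_to xs ` E" "\<And>A'. A' \<in> up_to xs ` E \<Longrightarrow> A \<subseteq> A' \<Longrightarrow> A = A'"
      using finite_has_maximal[of "up_to xs ` E"] finE False by auto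
    then obtain x where x: "x \<in> E" "A = up_to xs x" by auto
    have "E \<subseteq> up_to xs x"
    proof
      fix y assume "y \<in> E"
      then have "up_to xs y \<subseteq> up_to xs x"
        using up_to_chain[of x xs y] A(2)[of "up_to xs y"] x E by blast
      then show "y \<in> up_to xs x" using up_to_self[of y xs] by blast
    qed
    then have "event_prob S n F E \<le> event_prob S n F (up_to xs x)"
      by (intro event_prob_mono) (simp add: up_to_def)
    also have "\<dots> \<le> \<alpha>"
      using x(1) by (intro event_prob_le_of_least_plausible_mean F)
        (auto simp: E_def ranking_bound_def)
    finally show ?thesis .
  qed
  then show "event_prob S n F {x \<in> sample_space S n. ranking_bound S n \<alpha> xs x > ereal (mean S F)} \<le> \<alpha>"
    by (simp add: E_def)
qed

text \<open>If some plausible mean for \<open>A\<close> lay below \<open>B x\<close>, all of \<open>A\<close> would be in the error event.\<close>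

lemma valid_bound_le_least_plausible_mean:
  assumes "finite S" and B: "valid_bound S n \<alpha> B" and A: "A \<subseteq> sample_space S n"
    and above: "\<And>z. z \<in> A \<Longrightarrow> B x \<le> B z"
  shows "B x \<le> least_plausible_mean S n \<alpha> A"
  unfolding least_plausible_mean_def
proof (rule INF_greatest, rule ccontr)
  fix F assume F: "F \<in> {F \<in> distributions S. event_prob S n F A > \<alpha>}"
  let ?E = "{z \<in> sample_space S n. B z > ereal (mean S F)}"
  assume "\<not> B x \<le> ereal (mean S F)"
  then have "A \<subseteq> ?E" using A above by (force intro: less_le_trans)
  then have "event_prob S n F A \<le> event_prob S n F ?E"
    using finite_sample_space[OF \<open>finite S\<close>] by (intro event_prob_mono) auto
  also have "\<dots> \<le> \<alpha>" using B F by (auto simp: valid_bound_def)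
  finally show False using F by simp
qed

section \<open>Counting\<close>

lemma admissible_bound_eqI:
  assumes B: "admissible_bound S n \<alpha> B" and B': "valid_bound S n \<alpha> B'"
    and le: "\<And>x. x \<in> sample_space S n \<Longrightarrow> B x \<le> B' x"
  shows "B = B'"
proof (rule PiE_ext)
  show "B \<in> sample_space S n \<rightarrow>\<^sub>E UNIV" "B' \<in> sample_space S n \<rightarrow>\<^sub>E UNIV"
    using B B' by (auto simp: admissible_bound_def valid_bound_def lower_bounds_def)
  show "B x = B' x" if "x \<in> sample_space S n" for x
    using that assms by (force simp: admissible_bound_def dominates_def order_le_less)
qed

text \<open>The ranking lists the other samples by decreasing \<open>B\<close>; the constant sample is put last
  regardless of its value under \<open>B\<close>.\<close>

lemma admissible_bound_is_ranking_bound: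
  assumes "finite S" and "S \<noteq> {}" and "0 < \<alpha>" and "\<alpha> < 1" and B: "admissible_bound S n \<alpha> B"
  defines "x0 \<equiv> replicate n (Min S)"
  obtains xs where "xs \<in> permutations_of_set (sample_space S n - {x0})"
    and "B = ranking_bound S n \<alpha> (xs @ [x0])"
proof -
  have m: "Min S \<in> S" using assms by simp
  then have x0: "x0 \<in> sample_space S n"
    by (auto simp: x0_def sample_space_def)
  have valid: "valid_bound S n \<alpha> B" using B by (simp add: admissible_bound_def)
  obtain ys where ys: "set ys = sample_space S n - {x0}" "distinct ys"
    using finite_distinct_list[of "sample_space S n - {x0}"] finite_sample_space[OF \<open>finite S\<close>]
    by auto
  define xs where "xs = sort_key (\<lambda>x. - B x) ys"
  have xs: "set xs = sample_space S n - {x0}" "distinct xs"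
    using ys by (simp_all add: xs_def)
  have sorted: "sorted_wrt (\<lambda>x y. B y \<le> B x) xs"
    using sorted_sort_key[of "\<lambda>x. - B x" ys] by (simp add: xs_def sorted_map)
  have "B = ranking_bound S n \<alpha> (xs @ [x0])"
  proof (rule admissible_bound_eqI[OF B])
    show "valid_bound S n \<alpha> (ranking_bound S n \<alpha> (xs @ [x0]))"
      using assms xs x0 by (intro valid_bound_ranking_bound) auto
    fix x assume x: "x \<in> sample_space S n"
    have "B x \<le> least_plausible_mean S n \<alpha> (up_to (xs @ [x0]) x)"
    proof (cases "x = x0")
      case True
      have "B x0 \<le> ereal (Min S)"
        unfolding x0_def using assms m valid by (intro valid_bound_replicate_le) auto
      also have "\<dots> \<le> least_plausible_mean S n \<alpha> (up_to (xs @ [x0]) x)"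
        using \<open>finite S\<close> by (rule Min_le_least_plausible_mean)
      finally show ?thesis using True by simp
    next
      case False
      then have "x \<in> set xs" using x xs by simp
      moreover have "B x \<le> B z" if "z \<in> up_to xs x" for z
        using sorted_wrt_up_to[OF sorted _ \<open>x \<in> set xs\<close> that] by (simp add: reflp_def)
      ultimately show ?thesis
        using assms valid xs up_to_subset[of x xs]
        by (auto simp: up_to_append intro!: valid_bound_le_least_plausible_mean)
    qed
    then show "B x \<le> ranking_bound S n \<alpha> (xs @ [x0]) x"
      using x by (simp add: ranking_bound_def)
  qed
  with xs show ?thesis by (intro that) (auto simp: permutations_of_set_def)
qed

theorem corollary3p14:
  fixes S :: "real set" and n :: nat and \<alpha> :: real
  assumes "finite S" and "S \<noteq> {}" and "n \<ge> 1" and "0 < \<alpha>" and "\<alpha> < 1"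
  shows "finite {B. admissible_bound S n \<alpha> B} \<and>
    card {B. admissible_bound S n \<alpha> B} \<le> fact (card (sample_space S n) - 1)"
proof -
  let ?x0 = "replicate n (Min S)"
  let ?P = "permutations_of_set (sample_space S n - {?x0})"
  have "?x0 \<in> sample_space S n"
    using assms by (auto simp: sample_space_def)
  then have card: "card ?P = fact (card (sample_space S n) - 1)"
    using finite_sample_space[OF \<open>finite S\<close>] by simp
  have fin: "finite ?P" by simp
  have "{B. admissible_bound S n \<alpha> B} \<subseteq> (\<lambda>xs. ranking_bound S n \<alpha> (xs @ [?x0])) ` ?P"
    using admissible_bound_is_ranking_bound[OF assms(1,2,4,5)] by blast
  from finite_subset[OF this] surj_card_le[OF fin this] show ?thesis
    using card fin by simp
qed

end
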